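(* Let $\mathcal P_1$ and $\mathcal P_2$ be finite posets (possibly empty), let $k\geq 2$ be an integer, and let $\mathcal A_k$ be the antichain of size $k$. Let $n\geq 1$, and let $\mathcal F$ be a $\mathcal P_1*\mathcal A_k*\mathcal P_2$-saturated family with ground set $[n]$. Then $|\mathcal F|\geq\frac{n+1}{9}$.
   Context: $[n]=\{1,\dots,n\}$, and families of subsets of $[n]$ are ordered by inclusion. A poset $(\mathcal Q,\preceq)$ contains an induced copy of a poset $(\mathcal P,\preceq')$ if there is an injective order-preserving function $f:\mathcal P\to\mathcal Q$ such that $(f(\mathcal P),\preceq)$ is isomorphic to $(\mathcal P,\preceq')$. For a finite poset $\mathcal P$, a family $\mathcal F$ of subsets of $[n]$ (i.e. a family with ground set $[n]$) is $\mathcal P$-saturated if $\mathcal F$ contains no induced copy of $\mathcal P$ and, for every subset $S\subseteq[n]$ with $S\notin\mathcal F$, the family $\mathcal F\cup\{S\}$ contains an induced copy of $\mathcal P$. For finite posets $\mathcal Q_1,\mathcal Q_2$, the linear sum $\mathcal Q_1*\mathcal Q_2$ is the poset consisting of an induced copy of $\mathcal Q_1$ placed completely above an induced copy of $\mathcal Q_2$, i.e. every element of $\mathcal Q_1$ is strictly greater than every element of $\mathcal Q_2$; if one of the two posets is empty, $\mathcal Q_1*\mathcal Q_2$ is the other one. This operation is associative. *)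

theory Defs
  imports Complex_Main
begin

text \<open>
  A poset is a relation \<^term>\<open>r\<close> with \<^term>\<open>Partial_order r\<close>, i.e. a (reflexive)
  partial order on its field. Since an order relation is reflexive, the ground set is
  \<^term>\<open>Field r\<close>; in particular the empty relation is the empty poset.
\<close>

definition poset_isomorphic :: "'a rel \<Rightarrow> 'b rel \<Rightarrow> bool" where
  "poset_isomorphic r s \<longleftrightarrow>
     (\<exists>f. bij_betw f (Field r) (Field s) \<and>
          (\<forall>x\<in>Field r. \<forall>y\<in>Field r. (x, y) \<in> r \<longleftrightarrow> (f x, f y) \<in> s))"

definition contains_induced_copy :: "'b rel \<Rightarrow> 'a rel \<Rightarrow> bool" where
  "contains_induced_copy q p \<longleftrightarrow>
     (\<exists>f. f ` Field p \<subseteq> Field q \<and> inj_on f (Field p) \<and>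
          (\<forall>x y. (x, y) \<in> p \<longrightarrow> (f x, f y) \<in> q) \<and>
          poset_isomorphic (Restr q (f ` Field p)) p)"

definition inclusion_order :: "'a set set \<Rightarrow> 'a set rel" where
  "inclusion_order F = relation_of (\<subseteq>) F"

definition saturated :: "nat \<Rightarrow> 'a rel \<Rightarrow> nat set set \<Rightarrow> bool" where
  "saturated n p F \<longleftrightarrow>
     F \<subseteq> Pow {1..n} \<and>
     \<not> contains_induced_copy (inclusion_order F) p \<and>
     (\<forall>S. S \<subseteq> {1..n} \<longrightarrow> S \<notin> F \<longrightarrow> contains_induced_copy (inclusion_order (insert S F)) p)"

text \<open>A pair \<open>(x, y)\<close> in a relation means that \<open>x\<close> is below \<open>y\<close>; the first summand is on top.\<close>

definition linear_sum :: "'a rel \<Rightarrow> 'b rel \<Rightarrow> ('a + 'b) rel" where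
  "linear_sum r s =
     {(Inl x, Inl y) | x y. (x, y) \<in> r} \<union>
     {(Inr x, Inr y) | x y. (x, y) \<in> s} \<union>
     {(Inr y, Inl x) | x y. x \<in> Field r \<and> y \<in> Field s}"

definition antichain_poset :: "nat \<Rightarrow> nat rel" where
  "antichain_poset k = Id_on {1..k}"

end

theory Submission
  imports Defs
begin

text \<open>
  The proof shows more, namely that \<open>n \<le> card F + 1\<close>, by linear algebra: a real weight \<open>w\<close> on
  the ground set \<open>E\<close> that sums to zero over \<open>E\<close> and over every member of \<open>F\<close> must vanish, so
  the \<open>card F + 1\<close> homogeneous equations must be at least as many as the \<open>n\<close> unknowns.

  Suppose that \<open>w\<close> does not vanish. Let \<open>Q\<close> be its support, \<open>Z\<close> its set of zeros and \<open>Pos\<close> the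
  set where it is positive. No set of nonzero weight lies in \<open>F\<close>, so each such set \<open>X\<close>
  completes a copy of \<open>P1 * A_k * P2\<close>, in which it belongs to the top, the middle or the bottom
  layer. The sets \<open>X = Pos \<union> Z'\<close> with \<open>Z' \<subseteq> Z\<close> are extremal: a member of \<open>F\<close> inside \<open>X\<close> lies
  in \<open>Z'\<close>, and a member of \<open>F\<close> that contains \<open>X\<close> contains \<open>Q \<union> Z'\<close>. Such an \<open>X\<close> is thus
  felt by \<open>F\<close> like \<open>Z'\<close> from above and like \<open>Q \<union> Z'\<close> from below. Call a set high if it contains
  a copy of \<open>P2\<close> in \<open>F\<close>, and deep if it lies below a copy of \<open>P1\<close> in \<open>F\<close>. The extremal sets
  show that neither property depends on the points of \<open>Q\<close> (lemmas \<open>high_Int_zeros\<close> and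
  \<open>deep_Un_support\<close>), and that a minimal high set lies in \<open>F\<close>, is deep and avoids \<open>Q\<close>
  (lemma \<open>minimal_high\<close>).

  Now fix \<open>i \<in> Q\<close> and let \<open>A\<close> be maximal among the members of \<open>F\<close> that are high, deep and avoid
  \<open>i\<close>. Then \<open>insert i A\<close> has nonzero weight and is still high and deep, so it is not in \<open>F\<close> and
  completes a copy of the poset from its middle layer. The set \<open>A\<close> cannot replace \<open>insert i A\<close>
  there, hence \<open>A\<close> is strictly below another member \<open>B\<close> of the middle layer. By maximality
  \<open>i \<in> B\<close>, and so \<open>insert i A \<subseteq> B\<close>, although the two belong to an antichain.
\<close>

section \<open>Homogeneous linear systems\<close>

text \<open>Gaussian elimination, one equation at a time.\<close>

lemma nontrivial_solution:
  fixes a :: "'j \<Rightarrow> 'i \<Rightarrow> real"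
  assumes "finite J" and "finite I" and "card J < card I"
  shows "\<exists>w. (\<exists>i\<in>I. w i \<noteq> 0) \<and> (\<forall>j\<in>J. (\<Sum>i\<in>I. a j i * w i) = 0)"
  using assms
proof (induction J arbitrary: I a rule: finite_induct)
  case empty
  then obtain i where "i \<in> I"
    by fastforce
  then show ?case
    by (intro exI[of _ "\<lambda>_. 1"]) auto
next
  case (insert j J)
  show ?case
  proof (cases "\<forall>i\<in>I. a j i = 0")
    case True
    have "card J < card I"
      using insert.hyps insert.prems by simp
    from insert.IH[OF insert.prems(1) this, of a] True show ?thesis
      by auto
  next
    case False
    then obtain p where p: "p \<in> I" "a j p \<noteq> 0"
      by blast
    define b where "b l i = a l i - a l p / a j p * a j i" for l i
    have "card J < card (I - {p})"
      using insert.hyps insert.prems p by simp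
    from insert.IH[OF _ this, of b] insert.prems obtain v where
      v: "\<exists>i\<in>I - {p}. v i \<noteq> 0" "\<forall>l\<in>J. (\<Sum>i\<in>I - {p}. b l i * v i) = 0"
      by auto
    define s where "s l = (\<Sum>i\<in>I - {p}. a l i * v i)" for l
    define w where "w = v(p := - s j / a j p)"
    have split: "(\<Sum>i\<in>I. a l i * w i) = s l - a l p / a j p * s j" for l
    proof -
      have "(\<Sum>i\<in>I. a l i * w i) = a l p * w p + (\<Sum>i\<in>I - {p}. a l i * w i)"
        using insert.prems p by (simp add: sum.remove)
      also have "(\<Sum>i\<in>I - {p}. a l i * w i) = s l"
        unfolding s_def w_def by (intro sum.cong) auto
      finally show ?thesis
        by (simp add: w_def)
    qed
    have "s l - a l p / a j p * s j = 0" if "l \<in> J" for l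
    proof -
      have "(\<Sum>i\<in>I - {p}. b l i * v i) = s l - a l p / a j p * s j"
        unfolding b_def s_def by (simp add: algebra_simps sum_subtractf sum_distrib_left)
      then show ?thesis
        using v(2) that by simp
    qed
    moreover have "\<exists>i\<in>I. w i \<noteq> 0"
      using v(1) by (auto simp: w_def)
    ultimately show ?thesis
      using p by (intro exI[of _ w]) (auto simp: split)
  qed
qed

lemma nontrivial_null_weight:
  fixes E :: "'i set"
  assumes "finite E" and "\<A> \<subseteq> Pow E" and "card \<A> < card E"
  shows "\<exists>w :: 'i \<Rightarrow> real. (\<exists>i\<in>E. w i \<noteq> 0) \<and> (\<forall>A\<in>\<A>. sum w A = 0)"
proof -
  have "finite \<A>"
    using assms finite_subset by blast
  from nontrivial_solution[OF this assms(1,3), of "\<lambda>A i. of_bool (i \<in> A)"]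
  obtain w :: "'i \<Rightarrow> real" where
    w: "\<exists>i\<in>E. w i \<noteq> 0" "\<forall>A\<in>\<A>. (\<Sum>i\<in>E. of_bool (i \<in> A) * w i) = 0"
    by blast
  have "(\<Sum>i\<in>E. of_bool (i \<in> A) * w i) = sum w A" if "A \<in> \<A>" for A
  proof -
    have "sum w A = (\<Sum>i\<in>E. if i \<in> A then w i else 0)"
      using assms that by (intro sum.mono_neutral_cong_left) auto
    also have "\<dots> = (\<Sum>i\<in>E. of_bool (i \<in> A) * w i)"
      by (intro sum.cong) auto
    finally show ?thesis
      by simp
  qed
  with w show ?thesis
    by auto
qed

section \<open>Families saturated for a three-layered pattern\<close>

definition antichain :: "'a set set \<Rightarrow> bool" where
  "antichain \<A> \<longleftrightarrow> (\<forall>A\<in>\<A>. \<forall>B\<in>\<A>. A \<subseteq> B \<longrightarrow> A = B)"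

definition below :: "'a set set \<Rightarrow> 'a set set \<Rightarrow> bool" where
  "below \<A> \<B> \<longleftrightarrow> (\<forall>A\<in>\<A>. \<forall>B\<in>\<B>. A \<subset> B)"

text \<open>
  The outer layers enter the argument only through the question which families are copies of
  them; for this reason they are arbitrary predicates on families.
\<close>

definition layered ::
  "('a set set \<Rightarrow> bool) \<Rightarrow> nat \<Rightarrow> ('a set set \<Rightarrow> bool) \<Rightarrow> 'a set set \<Rightarrow> bool" where
  "layered is_top k is_bot F \<longleftrightarrow>
     (\<exists>\<T> \<A> \<L>. \<T> \<subseteq> F \<and> \<A> \<subseteq> F \<and> \<L> \<subseteq> F \<and> is_top \<T> \<and> is_bot \<L> \<and>
        antichain \<A> \<and> card \<A> = k \<and> below \<A> \<T> \<and> below \<L> \<A>)"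

lemma antichain_two:
  assumes "card \<A> \<ge> 2"
  obtains A B where "A \<in> \<A>" "B \<in> \<A>" "A \<noteq> B"
proof -
  have "\<A> \<noteq> {}"
    using assms by auto
  then obtain A where "A \<in> \<A>"
    by blast
  moreover have "\<not> \<A> \<subseteq> {A}"
    using assms card_mono[of "{A}" \<A>] by auto
  ultimately show thesis
    using that by blast
qed

locale layered_saturated =
  fixes E :: "'a set" and F :: "'a set set"
    and is_top is_bot :: "'a set set \<Rightarrow> bool" and k :: nat
  assumes finite_ground: "finite E"
    and F_ground: "F \<subseteq> Pow E"
    and k_ge_2: "k \<ge> 2"
    and not_layered: "\<not> layered is_top k is_bot F"
    and layered_insert: "\<And>S. S \<subseteq> E \<Longrightarrow> S \<notin> F \<Longrightarrow> layered is_top k is_bot (insert S F)"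
begin

text \<open>
  Weak inclusion makes \<open>high\<close> and \<open>deep\<close> statements about the union of the copy below and the
  intersection of the copy above; where strictness matters, the antichain supplies it (lemma
  \<open>no_antichain_between\<close>).
\<close>

definition high :: "'a set \<Rightarrow> bool" where
  "high S \<longleftrightarrow> (\<exists>\<L>\<subseteq>F. is_bot \<L> \<and> (\<forall>L\<in>\<L>. L \<subseteq> S))"

definition deep :: "'a set \<Rightarrow> bool" where
  "deep S \<longleftrightarrow> (\<exists>\<T>\<subseteq>F. is_top \<T> \<and> (\<forall>T\<in>\<T>. S \<subseteq> T))"

lemma highI:
  assumes "\<L> \<subseteq> F" "is_bot \<L>" "\<And>L. L \<in> \<L> \<Longrightarrow> L \<subseteq> S"
  shows "high S"
  unfolding high_def using assms by (intro exI[of _ \<L>]) auto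

lemma highE:
  assumes "high S"
  obtains \<L> where "\<L> \<subseteq> F" "is_bot \<L>" "\<And>L. L \<in> \<L> \<Longrightarrow> L \<subseteq> S"
  using assms unfolding high_def by auto

lemma deepI:
  assumes "\<T> \<subseteq> F" "is_top \<T>" "\<And>T. T \<in> \<T> \<Longrightarrow> S \<subseteq> T"
  shows "deep S"
  unfolding deep_def using assms by (intro exI[of _ \<T>]) auto

lemma deepE:
  assumes "deep S"
  obtains \<T> where "\<T> \<subseteq> F" "is_top \<T>" "\<And>T. T \<in> \<T> \<Longrightarrow> S \<subseteq> T"
  using assms unfolding deep_def by auto

lemma high_mono:
  assumes "high S" "S \<subseteq> S'"
  shows "high S'"
  using assms(1)
proof (rule highE)
  fix \<L>
  assume "\<L> \<subseteq> F" "is_bot \<L>" "\<And>L. L \<in> \<L> \<Longrightarrow> L \<subseteq> S"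
  then show ?thesis
    using assms(2) by (intro highI[of \<L>]) auto
qed

lemma deep_antimono:
  assumes "deep S" "S' \<subseteq> S"
  shows "deep S'"
  using assms(1)
proof (rule deepE)
  fix \<T>
  assume "\<T> \<subseteq> F" "is_top \<T>" "\<And>T. T \<in> \<T> \<Longrightarrow> S \<subseteq> T"
  then show ?thesis
    using assms(2) by (intro deepI[of \<T>]) auto
qed

text \<open>
  An antichain with at least two members forces strict inclusions for free: a set that lies
  weakly below, or weakly above, all its members cannot be one of them.
\<close>

lemma no_antichain_between:
  assumes "\<A> \<subseteq> F" "antichain \<A>" "card \<A> = k"
    and "\<T> \<subseteq> F" "is_top \<T>" "\<And>A T. A \<in> \<A> \<Longrightarrow> T \<in> \<T> \<Longrightarrow> A \<subseteq> T"
    and "\<L> \<subseteq> F" "is_bot \<L>" "\<And>A L. A \<in> \<A> \<Longrightarrow> L \<in> \<L> \<Longrightarrow> L \<subseteq> A"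
  shows False
proof -
  obtain A B where AB: "A \<in> \<A>" "B \<in> \<A>" "A \<noteq> B"
    using antichain_two assms(3) k_ge_2 by metis
  have "T \<notin> \<A>" if "T \<in> \<T>" for T
    using assms(2) assms(6)[OF _ that] AB unfolding antichain_def by metis
  moreover have "L \<notin> \<A>" if "L \<in> \<L>" for L
    using assms(2) assms(9)[OF _ that] AB unfolding antichain_def by metis
  ultimately have "below \<A> \<T>" "below \<L> \<A>"
    using assms(6,9) unfolding below_def by blast+
  then have "layered is_top k is_bot F"
    unfolding layered_def using assms by blast
  then show False
    using not_layered by simp
qed

text \<open>
  A missing set occurs in exactly one layer of the copy that it completes, because the layers
  are strictly separated; hence the other two layers are contained in \<open>F\<close>.
\<close>

lemma missing_set_cases:
  assumes "X \<subseteq> E" "X \<notin> F"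
  obtains
    (bottom) \<T> \<A> where "\<T> \<subseteq> F" "is_top \<T>" "\<A> \<subseteq> F" "antichain \<A>" "card \<A> = k"
      "below \<A> \<T>" "\<And>A. A \<in> \<A> \<Longrightarrow> X \<subset> A"
  | (middle) \<T> \<A> \<L> where "\<T> \<subseteq> F" "is_top \<T>" "\<L> \<subseteq> F" "is_bot \<L>" "\<A> \<subseteq> insert X F" "X \<in> \<A>"
      "antichain \<A>" "card \<A> = k" "below \<A> \<T>" "below \<L> \<A>"
  | (top) \<A> \<L> where "\<L> \<subseteq> F" "is_bot \<L>" "\<A> \<subseteq> F" "antichain \<A>" "card \<A> = k"
      "below \<L> \<A>" "\<And>A. A \<in> \<A> \<Longrightarrow> A \<subset> X"
proof -
  from layered_insert[OF assms] obtain \<T> \<A> \<L> where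
    sub: "\<T> \<subseteq> insert X F" "\<A> \<subseteq> insert X F" "\<L> \<subseteq> insert X F" and
    L: "is_top \<T>" "is_bot \<L>" "antichain \<A>" "card \<A> = k" "below \<A> \<T>" "below \<L> \<A>"
    unfolding layered_def by blast
  obtain A where A: "A \<in> \<A>"
    using antichain_two L(4) k_ge_2 by metis
  have TL: "L \<subset> T" if "L \<in> \<L>" "T \<in> \<T>" for L T
    using L(5,6) A that unfolding below_def by (meson psubset_trans)
  consider "X \<in> \<L>" | "X \<in> \<A>" | "X \<in> \<T>" | "X \<notin> \<L>" "X \<notin> \<A>" "X \<notin> \<T>"
    by blast
  then show thesis
  proof cases
    case 1
    have "X \<notin> \<A>" "X \<notin> \<T>"
      using 1 TL L(6) unfolding below_def by blast+
    then have "\<T> \<subseteq> F" "\<A> \<subseteq> F"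
      using sub by blast+
    moreover have "X \<subset> A" if "A \<in> \<A>" for A
      using 1 L(6) that unfolding below_def by blast
    ultimately show thesis
      using bottom[of \<T> \<A>] L by simp
  next
    case 2
    have "X \<notin> \<L>" "X \<notin> \<T>"
      using 2 L(5,6) unfolding below_def by blast+
    then have "\<L> \<subseteq> F" "\<T> \<subseteq> F"
      using sub by blast+
    then show thesis
      using middle[of \<T> \<L> \<A>] 2 sub(2) L by simp
  next
    case 3
    have "X \<notin> \<A>" "X \<notin> \<L>"
      using 3 TL L(5) unfolding below_def by blast+
    then have "\<L> \<subseteq> F" "\<A> \<subseteq> F"
      using sub by blast+
    moreover have "A \<subset> X" if "A \<in> \<A>" for A
      using 3 L(5) that unfolding below_def by blast
    ultimately show thesis
      using top[of \<L> \<A>] L by simp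
  next
    case 4
    then have "\<T> \<subseteq> F" "\<A> \<subseteq> F" "\<L> \<subseteq> F"
      using sub by blast+
    then have "layered is_top k is_bot F"
      unfolding layered_def using L by metis
    then show thesis
      using not_layered by simp
  qed
qed

lemma antichain_above_if_not_high:
  assumes "X \<subseteq> E" "X \<notin> F" "\<not> high X"
  obtains \<T> \<A> where "\<T> \<subseteq> F" "is_top \<T>" "\<A> \<subseteq> F" "antichain \<A>" "card \<A> = k"
    "below \<A> \<T>" "\<And>A. A \<in> \<A> \<Longrightarrow> X \<subset> A"
proof (rule missing_set_cases[OF assms(1,2)])
  fix \<T> \<A> \<L>
  assume "\<L> \<subseteq> F" "is_bot \<L>" "X \<in> \<A>" "below \<L> \<A>"
  then have "high X"
    unfolding below_def by (intro highI[of \<L>]) auto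
  with assms show thesis by simp
next
  fix \<A> \<L>
  assume *: "\<L> \<subseteq> F" "is_bot \<L>" "card \<A> = k" "below \<L> \<A>" "\<And>A. A \<in> \<A> \<Longrightarrow> A \<subset> X"
  obtain A where "A \<in> \<A>"
    using antichain_two *(3) k_ge_2 by metis
  with * have "L \<subseteq> X" if "L \<in> \<L>" for L
    using that unfolding below_def by blast
  with *(1,2) have "high X"
    by (rule highI)
  with assms show thesis by simp
next
  fix \<T> \<A>
  assume "\<T> \<subseteq> F" "is_top \<T>" "\<A> \<subseteq> F" "antichain \<A>" "card \<A> = k" "below \<A> \<T>"
    "\<And>A. A \<in> \<A> \<Longrightarrow> X \<subset> A"
  then show thesis
    by (rule that)
qed

lemma antichain_below_if_not_deep:
  assumes "X \<subseteq> E" "X \<notin> F" "\<not> deep X"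
  obtains \<A> \<L> where "\<L> \<subseteq> F" "is_bot \<L>" "\<A> \<subseteq> F" "antichain \<A>" "card \<A> = k"
    "below \<L> \<A>" "\<And>A. A \<in> \<A> \<Longrightarrow> A \<subset> X"
proof (rule missing_set_cases[OF assms(1,2)])
  fix \<T> \<A> \<L>
  assume "\<T> \<subseteq> F" "is_top \<T>" "X \<in> \<A>" "below \<A> \<T>"
  then have "deep X"
    unfolding below_def by (intro deepI[of \<T>]) auto
  with assms show thesis by simp
next
  fix \<T> \<A>
  assume *: "\<T> \<subseteq> F" "is_top \<T>" "card \<A> = k" "below \<A> \<T>" "\<And>A. A \<in> \<A> \<Longrightarrow> X \<subset> A"
  obtain A where "A \<in> \<A>"
    using antichain_two *(3) k_ge_2 by metis
  with * have "X \<subseteq> T" if "T \<in> \<T>" for T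
    using that unfolding below_def by blast
  with *(1,2) have "deep X"
    by (rule deepI)
  with assms show thesis by simp
next
  fix \<A> \<L>
  assume "\<L> \<subseteq> F" "is_bot \<L>" "\<A> \<subseteq> F" "antichain \<A>" "card \<A> = k" "below \<L> \<A>"
    "\<And>A. A \<in> \<A> \<Longrightarrow> A \<subset> X"
  then show thesis
    by (rule that)
qed

text \<open>
  A high set cannot be in the bottom layer, since the copy of that layer inside it could be put
  in its place, and likewise a deep set cannot be in the top layer.
\<close>

lemma middle_if_high_deep:
  assumes "X \<subseteq> E" "X \<notin> F" "high X" "deep X"
  obtains \<T> \<A> \<L> where "\<T> \<subseteq> F" "is_top \<T>" "\<L> \<subseteq> F" "is_bot \<L>" "\<A> \<subseteq> insert X F" "X \<in> \<A>"
    "antichain \<A>" "card \<A> = k" "below \<A> \<T>" "below \<L> \<A>"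
proof (rule missing_set_cases[OF assms(1,2)])
  fix \<T> \<A>
  assume *: "\<T> \<subseteq> F" "is_top \<T>" "\<A> \<subseteq> F" "antichain \<A>" "card \<A> = k" "below \<A> \<T>"
    "\<And>A. A \<in> \<A> \<Longrightarrow> X \<subset> A"
  obtain \<L> where L: "\<L> \<subseteq> F" "is_bot \<L>" "\<And>L. L \<in> \<L> \<Longrightarrow> L \<subseteq> X"
    using assms(3) by (rule highE) blast
  have "A \<subseteq> T" if "A \<in> \<A>" "T \<in> \<T>" for A T
    using *(6) that unfolding below_def by blast
  moreover have "L \<subseteq> A" if "A \<in> \<A>" "L \<in> \<L>" for A L
    using *(7) L(3) that by blast
  ultimately have False
    using no_antichain_between[of \<A> \<T> \<L>] * L by metis
  then show thesis ..
next
  fix \<A> \<L>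
  assume *: "\<L> \<subseteq> F" "is_bot \<L>" "\<A> \<subseteq> F" "antichain \<A>" "card \<A> = k" "below \<L> \<A>"
    "\<And>A. A \<in> \<A> \<Longrightarrow> A \<subset> X"
  obtain \<T> where T: "\<T> \<subseteq> F" "is_top \<T>" "\<And>T. T \<in> \<T> \<Longrightarrow> X \<subseteq> T"
    using assms(4) by (rule deepE) blast
  have "L \<subseteq> A" if "A \<in> \<A>" "L \<in> \<L>" for A L
    using *(6) that unfolding below_def by blast
  moreover have "A \<subseteq> T" if "A \<in> \<A>" "T \<in> \<T>" for A T
    using *(7) T(3) that by blast
  ultimately have False
    using no_antichain_between[of \<A> \<T> \<L>] * T by metis
  then show thesis ..
next
  fix \<T> \<A> \<L>
  assume "\<T> \<subseteq> F" "is_top \<T>" "\<L> \<subseteq> F" "is_bot \<L>" "\<A> \<subseteq> insert X F" "X \<in> \<A>"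
    "antichain \<A>" "card \<A> = k" "below \<A> \<T>" "below \<L> \<A>"
  then show thesis
    by (rule that)
qed

end

section \<open>Weights that vanish on the family\<close>

locale null_weight = layered_saturated +
  fixes w :: "'a \<Rightarrow> real"
  assumes sum_F: "\<And>A. A \<in> F \<Longrightarrow> sum w A = 0"
    and sum_ground: "sum w E = 0"
    and nonzero: "\<exists>i\<in>E. w i \<noteq> 0"
begin

definition Q :: "'a set" where "Q = {i \<in> E. w i \<noteq> 0}"
definition Z :: "'a set" where "Z = {i \<in> E. w i = 0}"
definition Pos :: "'a set" where "Pos = {i \<in> E. w i > 0}"

lemma ground_split: "Q \<union> Z = E" "Q \<inter> Z = {}" "Pos \<subseteq> Q"
  unfolding Q_def Z_def Pos_def by auto

lemma member_in_Pos_Un_zeros: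
  assumes "A \<in> F" "A \<subseteq> Pos \<union> Z'" "Z' \<subseteq> Z"
  shows "A \<subseteq> Z'"
proof -
  have "finite A"
    using assms(1) F_ground finite_ground by (auto intro: finite_subset)
  moreover have "w i \<ge> 0" if "i \<in> A" for i
    using assms that unfolding Pos_def Z_def by force
  ultimately have "\<forall>i\<in>A. w i = 0"
    using sum_F[OF assms(1)] by (simp add: sum_nonneg_eq_0_iff)
  then show ?thesis
    using assms unfolding Pos_def by fastforce
qed

lemma member_containing_Pos:
  assumes "A \<in> F" "Pos \<subseteq> A"
  shows "Q \<subseteq> A"
proof -
  have "A \<subseteq> E"
    using assms F_ground by blast
  then have "sum w (E - A) = 0"
    using sum_F[OF assms(1)] sum_ground finite_ground by (simp add: sum_diff)
  then have "(\<Sum>i\<in>E - A. - w i) = 0"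
    by (simp add: sum_negf)
  moreover have "- w i \<ge> 0" if "i \<in> E - A" for i
    using assms that unfolding Pos_def by force
  ultimately have "\<forall>i\<in>E - A. - w i = 0"
    using finite_ground by (subst (asm) sum_nonneg_eq_0_iff) auto
  then show ?thesis
    unfolding Q_def by auto
qed

lemma Pos_Un_zeros_missing:
  assumes "Z' \<subseteq> Z"
  shows "Pos \<union> Z' \<notin> F"
proof
  assume X: "Pos \<union> Z' \<in> F"
  have "Pos \<subseteq> Z'"
    using member_in_Pos_Un_zeros[OF X _ assms] by blast
  moreover have "Q \<subseteq> Pos \<union> Z'"
    using member_containing_Pos[OF X] by blast
  ultimately have "Q \<subseteq> Z"
    using assms by blast
  then show False
    using nonzero ground_split unfolding Q_def by blast
qed

text \<open>
  If \<open>C \<inter> Z\<close> were not high, neither would be the extremal set over it. Each member of the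
  antichain above that set contains \<open>Q\<close>, hence \<open>C\<close>, so the antichain fits above the copy
  inside \<open>C\<close>.
\<close>

lemma high_Int_zeros:
  assumes "C \<subseteq> E" "high C"
  shows "high (C \<inter> Z)"
proof (rule ccontr)
  assume not_high: "\<not> high (C \<inter> Z)"
  let ?X = "Pos \<union> (C \<inter> Z)"
  have "\<not> high ?X"
  proof
    assume "high ?X"
    then obtain \<L> where L: "\<L> \<subseteq> F" "is_bot \<L>" "\<And>L. L \<in> \<L> \<Longrightarrow> L \<subseteq> ?X"
      by (rule highE) blast
    have "L \<subseteq> C \<inter> Z" if "L \<in> \<L>" for L
      using member_in_Pos_Un_zeros[of L "C \<inter> Z"] L(1) L(3)[OF that] that by blast
    with L(1,2) have "high (C \<inter> Z)"
      by (rule highI)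
    with not_high show False ..
  qed
  moreover have "?X \<notin> F" "?X \<subseteq> E"
    using Pos_Un_zeros_missing[of "C \<inter> Z"] ground_split by blast+
  ultimately obtain \<T> \<A> where
    TA: "\<T> \<subseteq> F" "is_top \<T>" "\<A> \<subseteq> F" "antichain \<A>" "card \<A> = k" "below \<A> \<T>" and
    X: "\<And>A. A \<in> \<A> \<Longrightarrow> ?X \<subset> A"
    using antichain_above_if_not_high[of ?X] by metis
  obtain \<L> where L: "\<L> \<subseteq> F" "is_bot \<L>" "\<And>L. L \<in> \<L> \<Longrightarrow> L \<subseteq> C"
    using assms(2) by (rule highE) blast
  have "C \<subseteq> A" if "A \<in> \<A>" for A
    using member_containing_Pos[of A] X[OF that] TA(3) that assms(1) ground_split by blast
  then have "L \<subseteq> A" if "A \<in> \<A>" "L \<in> \<L>" for A L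
    using L(3) that by blast
  moreover have "A \<subseteq> T" if "A \<in> \<A>" "T \<in> \<T>" for A T
    using TA(6) that unfolding below_def by blast
  ultimately show False
    using no_antichain_between[of \<A> \<T> \<L>] TA L by metis
qed

text \<open>Dually, if \<open>T \<union> Q\<close> were not deep, the extremal set over \<open>T \<inter> Z\<close> would be in a top layer,
  and the antichain below it fits below the copy above \<open>T\<close>.\<close>

lemma deep_Un_support:
  assumes "T \<subseteq> E" "deep T"
  shows "deep (T \<union> Q)"
proof (rule ccontr)
  assume not_deep: "\<not> deep (T \<union> Q)"
  let ?X = "Pos \<union> (T \<inter> Z)"
  have "\<not> deep ?X"
  proof
    assume "deep ?X"
    then obtain \<T> where T: "\<T> \<subseteq> F" "is_top \<T>" "\<And>A. A \<in> \<T> \<Longrightarrow> ?X \<subseteq> A"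
      by (rule deepE) blast
    have "T \<union> Q \<subseteq> A" if "A \<in> \<T>" for A
      using member_containing_Pos[of A] T(1) T(3)[OF that] that assms(1) ground_split(1) by blast
    with T(1,2) have "deep (T \<union> Q)"
      by (rule deepI)
    with not_deep show False ..
  qed
  moreover have "?X \<notin> F" "?X \<subseteq> E"
    using Pos_Un_zeros_missing[of "T \<inter> Z"] ground_split by blast+
  ultimately obtain \<A> \<L> where
    AL: "\<L> \<subseteq> F" "is_bot \<L>" "\<A> \<subseteq> F" "antichain \<A>" "card \<A> = k" "below \<L> \<A>" and
    X: "\<And>A. A \<in> \<A> \<Longrightarrow> A \<subset> ?X"
    using antichain_below_if_not_deep[of ?X] by metis
  obtain \<T> where T: "\<T> \<subseteq> F" "is_top \<T>" "\<And>S. S \<in> \<T> \<Longrightarrow> T \<subseteq> S"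
    using assms(2) by (rule deepE) blast
  have "A \<subseteq> T" if "A \<in> \<A>" for A
    using member_in_Pos_Un_zeros[of A "T \<inter> Z"] X[OF that] AL(3) that by blast
  then have "A \<subseteq> S" if "A \<in> \<A>" "S \<in> \<T>" for A S
    using T(3) that by blast
  moreover have "L \<subseteq> A" if "A \<in> \<A>" "L \<in> \<L>" for A L
    using AL(6) that unfolding below_def by blast
  ultimately show False
    using no_antichain_between[of \<A> \<T> \<L>] AL T by metis
qed

text \<open>
  Removing a point of \<open>Q\<close> from \<open>E\<close> leaves a set of nonzero weight. If it were not high, an
  antichain of at least two sets would lie strictly above it, but only \<open>E\<close> does.
\<close>

lemma high_ground: "high E"
proof (rule ccontr)
  assume "\<not> high E"
  obtain i where i: "i \<in> E" "w i \<noteq> 0"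
    using nonzero by blast
  have "sum w (E - {i}) = - w i"
    using i finite_ground sum_ground by (simp add: sum_diff1)
  then have "E - {i} \<notin> F"
    using sum_F i by force
  moreover have "\<not> high (E - {i})"
    using \<open>\<not> high E\<close> high_mono by blast
  ultimately obtain \<A> where A: "\<A> \<subseteq> F" "card \<A> = k" "\<And>A. A \<in> \<A> \<Longrightarrow> E - {i} \<subset> A"
    using antichain_above_if_not_high[of "E - {i}"] by (metis Diff_subset)
  obtain A B where "A \<in> \<A>" "B \<in> \<A>" "A \<noteq> B"
    using antichain_two A(2) k_ge_2 by metis
  moreover have "A = E" if "A \<in> \<A>" for A
    using A(1) A(3)[OF that] that F_ground by blast
  ultimately show False
    by blast
qed

text \<open>
  The witness is an inclusion-minimal high set \<open>C\<close>. A high set inside \<open>C\<close> equals \<open>C\<close>. If \<open>C\<close>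
  were not deep, \<open>Pos \<union> C\<close> would be in a top layer, over an antichain of high sets inside \<open>C\<close>;
  if \<open>C\<close> were missing from \<open>F\<close>, it would be in a middle layer, over a copy that only sets
  containing \<open>C\<close> can contain. Both contradict that the antichain has two members.
\<close>

lemma minimal_high:
  obtains C where "C \<in> F" "high C" "deep C" "C \<subseteq> Z"
proof -
  have "finite {S. S \<subseteq> E \<and> high S}"
    using finite_ground by (simp add: finite_subset[of _ "Pow E"] subset_iff)
  moreover have "{S. S \<subseteq> E \<and> high S} \<noteq> {}"
    using high_ground by blast
  ultimately obtain C where C: "C \<subseteq> E" "high C"
    and min: "\<And>S. S \<subseteq> E \<Longrightarrow> high S \<Longrightarrow> S \<subseteq> C \<Longrightarrow> S = C"
    using finite_has_minimal[of "{S. S \<subseteq> E \<and> high S}"] by (auto simp: eq_commute)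
  have CZ: "C \<subseteq> Z"
    using min[of "C \<inter> Z"] high_Int_zeros[OF C] C by blast
  have deep: "deep C"
  proof (rule ccontr)
    assume "\<not> deep C"
    let ?X = "Pos \<union> C"
    have "\<not> deep ?X"
      using \<open>\<not> deep C\<close> deep_antimono by blast
    moreover have "?X \<notin> F" "?X \<subseteq> E"
      using Pos_Un_zeros_missing[OF CZ] ground_split C by blast+
    ultimately obtain \<A> \<L> where
      AL: "\<L> \<subseteq> F" "is_bot \<L>" "\<A> \<subseteq> F" "card \<A> = k" "below \<L> \<A>" and
      X: "\<And>A. A \<in> \<A> \<Longrightarrow> A \<subset> ?X"
      using antichain_below_if_not_deep[of ?X] by metis
    have "A = C" if "A \<in> \<A>" for A
    proof (rule min)
      show "A \<subseteq> C"
        using member_in_Pos_Un_zeros[of A C] X[OF that] AL(3) that CZ by blast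
      then show "A \<subseteq> E"
        using C by blast
      show "high A"
        using AL(1,2,5) that unfolding below_def by (intro highI[of \<L>]) auto
    qed
    moreover obtain A B where "A \<in> \<A>" "B \<in> \<A>" "A \<noteq> B"
      using antichain_two AL(4) k_ge_2 by metis
    ultimately show False
      by blast
  qed
  have "C \<in> F"
  proof (rule ccontr)
    assume "C \<notin> F"
    from middle_if_high_deep[OF C(1) this C(2) deep] obtain \<A> \<L> where
      AL: "\<L> \<subseteq> F" "is_bot \<L>" "C \<in> \<A>" "antichain \<A>" "card \<A> = k" "below \<L> \<A>"
      by metis
    obtain B where B: "B \<in> \<A>" "B \<noteq> C"
      using antichain_two AL(5) k_ge_2 by metis
    \<comment> \<open>By minimality \<open>C\<close> is covered by the bottom layer, so it lies below \<open>B\<close>.\<close>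
    have "high (C \<inter> B)"
      using AL B unfolding below_def by (intro highI[of \<L>]) auto
    then have "C \<subseteq> B"
      using min[of "C \<inter> B"] C by blast
    then show False
      using AL(3,4) B unfolding antichain_def by metis
  qed
  with C CZ deep that show thesis
    by blast
qed

lemma no_null_weight: False
proof -
  obtain i where i: "i \<in> Q"
    using nonzero unfolding Q_def by blast
  define \<K> where "\<K> = {A \<in> F. high A \<and> deep A \<and> i \<notin> A}"
  have "finite \<K>"
    using finite_ground F_ground unfolding \<K>_def
    by (simp add: finite_subset[of _ "Pow E"] subset_iff)
  moreover obtain C where "C \<in> F" "high C" "deep C" "C \<subseteq> Z"
    by (rule minimal_high)
  then have "\<K> \<noteq> {}"
    using i ground_split unfolding \<K>_def by blast
  ultimately obtain A where "A \<in> \<K>" and max: "\<And>B. B \<in> \<K> \<Longrightarrow> A \<subseteq> B \<Longrightarrow> A = B"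
    using finite_has_maximal[of \<K>] by metis
  then have A: "A \<in> F" "high A" "deep A" "i \<notin> A"
    unfolding \<K>_def by blast+
  have "A \<subseteq> E"
    using A F_ground by blast
  let ?X = "insert i A"
  have X: "?X \<subseteq> E"
    using \<open>A \<subseteq> E\<close> i unfolding Q_def by blast
  have "finite A"
    using \<open>A \<subseteq> E\<close> finite_ground by (rule finite_subset)
  then have "sum w ?X = w i"
    using A sum_F by simp
  then have X_missing: "?X \<notin> F"
    using sum_F i unfolding Q_def by force
  have "high ?X"
    using A high_mono by blast
  moreover have "deep ?X"
    using deep_Un_support[OF \<open>A \<subseteq> E\<close> A(3)] i by (auto intro: deep_antimono)
  ultimately obtain \<T> \<A> \<L> where
    M: "\<T> \<subseteq> F" "is_top \<T>" "\<L> \<subseteq> F" "is_bot \<L>" "\<A> \<subseteq> insert ?X F" "?X \<in> \<A>"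
      "antichain \<A>" "card \<A> = k" "below \<A> \<T>" "below \<L> \<A>"
    using middle_if_high_deep[OF X X_missing] by metis
  have A_not_sub: "\<not> A \<subseteq> B" if B: "B \<in> \<A>" "B \<noteq> ?X" for B
  proof
    assume "A \<subseteq> B"
    have "B \<in> F"
      using M(5) B by blast
    moreover have "high B"
      using M(3,4,10) B(1) unfolding below_def by (intro highI[of \<L>]) auto
    moreover have "deep B"
      using M(1,2,9) B(1) unfolding below_def by (intro deepI[of \<T>]) auto
    moreover have "i \<notin> B"
      using M(6,7) B \<open>A \<subseteq> B\<close> unfolding antichain_def by (metis insert_subset)
    ultimately have "B = A"
      using max[of B] \<open>A \<subseteq> B\<close> unfolding \<K>_def by blast
    then show False
      using M(6,7) B unfolding antichain_def by (metis subset_insertI)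
  qed
  have not_sub_A: "\<not> B \<subseteq> A" if B: "B \<in> \<A>" "B \<noteq> ?X" for B
    using M(6,7) B unfolding antichain_def by (metis subset_insertI2)
  \<comment> \<open>The bottom layer may use \<open>i\<close>; it is replaced by a copy that does not and still lies
    below the whole middle layer.\<close>
  have "high (\<Inter>\<A>)"
    using M(3,4,10) unfolding below_def by (intro highI[of \<L>]) auto
  moreover have "\<Inter>\<A> \<subseteq> E"
    using M X by blast
  ultimately have "high (\<Inter>\<A> \<inter> Z)"
    by (intro high_Int_zeros)
  then obtain \<L>' where L': "\<L>' \<subseteq> F" "is_bot \<L>'" "\<And>L. L \<in> \<L>' \<Longrightarrow> L \<subseteq> \<Inter>\<A> \<inter> Z"
    by (rule highE) blast
  define \<A>' where "\<A>' = insert A (\<A> - {?X})"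
  have "finite \<A>"
    using M k_ge_2 by (intro card_ge_0_finite) simp
  moreover have "A \<notin> \<A> - {?X}"
    using A_not_sub by blast
  ultimately have "card \<A>' = k"
    unfolding \<A>'_def using M k_ge_2 by simp
  moreover have "antichain \<A>'"
    unfolding \<A>'_def antichain_def
    using M(7) A_not_sub not_sub_A unfolding antichain_def by blast
  moreover have "\<A>' \<subseteq> F"
    unfolding \<A>'_def using M A by blast
  moreover have "B \<subseteq> T" if "B \<in> \<A>'" "T \<in> \<T>" for B T
  proof -
    have "B \<subseteq> T" if "B \<in> \<A>" for B
      using M(9) that \<open>T \<in> \<T>\<close> unfolding below_def by auto
    then show ?thesis
      using M(6) \<open>B \<in> \<A>'\<close> unfolding \<A>'_def by auto
  qed
  moreover have "L \<subseteq> B" if "B \<in> \<A>'" "L \<in> \<L>'" for B L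
  proof -
    have "L \<subseteq> \<Inter>\<A>" "i \<notin> L"
      using L'(3)[OF that(2)] i ground_split by auto
    then show ?thesis
      using M(6) \<open>B \<in> \<A>'\<close> unfolding \<A>'_def by auto
  qed
  ultimately show False
    using no_antichain_between[of \<A>' \<T> \<L>'] M(1,2) L'(1,2) by metis
qed

end

context layered_saturated
begin

lemma finite_F: "finite F"
  using F_ground finite_ground by (auto intro: finite_subset)

lemma card_ground_le: "card E \<le> card F + 1"
proof (rule ccontr)
  assume "\<not> card E \<le> card F + 1"
  moreover have "card (insert E F) \<le> card F + 1"
    using finite_F by (simp add: card_insert_if)
  ultimately have "card (insert E F) < card E"
    by simp
  from nontrivial_null_weight[OF finite_ground _ this] obtain w :: "'a \<Rightarrow> real" where
    w: "\<exists>i\<in>E. w i \<noteq> 0" "\<forall>A\<in>insert E F. sum w A = 0"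
    using F_ground by auto
  interpret null_weight E F is_top is_bot k w
    by unfold_locales (use w in auto)
  show False
    by (rule no_null_weight)
qed

lemma F_nonempty: "F \<noteq> {}"
proof
  assume "F = {}"
  then obtain \<A> :: "'a set set" where "\<A> \<subseteq> {{}}" "card \<A> = k"
    using layered_insert[of "{}"] unfolding layered_def by auto
  then show False
    using k_ge_2 card_mono[of "{{}}" \<A>] by simp
qed

end

section \<open>Induced copies of linear sums\<close>

definition copy :: "'p rel \<Rightarrow> 'a set set \<Rightarrow> bool" where
  "copy p \<G> \<longleftrightarrow>
     (\<exists>f. \<G> = f ` Field p \<and> (\<forall>x\<in>Field p. \<forall>y\<in>Field p. (x, y) \<in> p \<longleftrightarrow> f x \<subseteq> f y))"

lemma copyI:
  assumes "\<G> = f ` Field p"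
    and "\<And>x y. x \<in> Field p \<Longrightarrow> y \<in> Field p \<Longrightarrow> (x, y) \<in> p \<longleftrightarrow> f x \<subseteq> f y"
  shows "copy p \<G>"
  unfolding copy_def by (intro exI[of _ f] conjI ballI assms)

lemma copyE:
  assumes "copy p \<G>"
  obtains f where "\<G> = f ` Field p"
    and "\<And>x y. x \<in> Field p \<Longrightarrow> y \<in> Field p \<Longrightarrow> (x, y) \<in> p \<longleftrightarrow> f x \<subseteq> f y"
  using assms unfolding copy_def by blast

lemma Field_inclusion_order: "Field (inclusion_order F) = F"
  unfolding Field_def inclusion_order_def relation_of_def by auto

lemma Field_Restr_inclusion_order:
  assumes "\<G> \<subseteq> F"
  shows "Field (Restr (inclusion_order F) \<G>) = \<G>"
proof -
  have "Restr (inclusion_order F) \<G> = inclusion_order \<G>"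
    using subsetD[OF assms] unfolding inclusion_order_def relation_of_def by auto
  then show ?thesis
    by (simp add: Field_inclusion_order)
qed

text \<open>
  The isomorphism in the definition of an induced copy is unrelated to the injection whose image
  it concerns; its inverse is the embedding that \<^const>\<open>copy\<close> asks for.
\<close>

lemma contains_induced_copy_iff:
  assumes "antisym p"
  shows "contains_induced_copy (inclusion_order F) p \<longleftrightarrow> (\<exists>\<G>\<subseteq>F. copy p \<G>)"
proof
  assume "contains_induced_copy (inclusion_order F) p"
  then obtain f where
    f: "f ` Field p \<subseteq> Field (inclusion_order F)"
    and iso: "poset_isomorphic (Restr (inclusion_order F) (f ` Field p)) p"
    unfolding contains_induced_copy_def by (elim exE conjE)
  let ?G = "f ` Field p"
  have sub: "?G \<subseteq> F"
    using f by (simp add: Field_inclusion_order)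
  from iso obtain g where
    g: "bij_betw g ?G (Field p)"
    and g_iff: "\<And>A B. A \<in> ?G \<Longrightarrow> B \<in> ?G \<Longrightarrow>
      (A, B) \<in> Restr (inclusion_order F) ?G \<longleftrightarrow> (g A, g B) \<in> p"
    unfolding poset_isomorphic_def Field_Restr_inclusion_order[OF sub] by auto
  let ?h = "inv_into ?G g"
  have h: "bij_betw ?h (Field p) ?G"
    using g by (rule bij_betw_inv_into)
  have "(x, y) \<in> p \<longleftrightarrow> ?h x \<subseteq> ?h y" if "x \<in> Field p" "y \<in> Field p" for x y
  proof -
    have hG: "?h x \<in> ?G" "?h y \<in> ?G"
      using bij_betwE[OF h] that by auto
    have "g (?h x) = x" "g (?h y) = y"
      using g that by (auto simp: bij_betw_inv_into_right)
    then have "(x, y) \<in> p \<longleftrightarrow> (?h x, ?h y) \<in> Restr (inclusion_order F) ?G"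
      using g_iff[OF hG] by simp
    also have "\<dots> \<longleftrightarrow> ?h x \<subseteq> ?h y"
      using hG subsetD[OF sub] unfolding inclusion_order_def relation_of_def by auto
    finally show ?thesis .
  qed
  moreover have "?G = ?h ` Field p"
    using h by (simp add: bij_betw_def)
  ultimately have "copy p ?G"
    by (intro copyI)
  with sub show "\<exists>\<G>\<subseteq>F. copy p \<G>"
    by blast
next
  assume "\<exists>\<G>\<subseteq>F. copy p \<G>"
  then obtain \<G> where G: "\<G> \<subseteq> F" "copy p \<G>"
    by auto
  from G(2) obtain f where f: "\<G> = f ` Field p"
    and iff: "\<And>x y. x \<in> Field p \<Longrightarrow> y \<in> Field p \<Longrightarrow> (x, y) \<in> p \<longleftrightarrow> f x \<subseteq> f y"
    by (rule copyE) blast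
  have sub: "f ` Field p \<subseteq> F"
    using G(1) f by simp
  let ?G = "f ` Field p"
  have inj: "inj_on f (Field p)"
    using iff assms by (intro inj_onI) (metis antisymD order_refl)
  have order: "(f x, f y) \<in> inclusion_order F \<longleftrightarrow> (x, y) \<in> p"
    if "x \<in> Field p" "y \<in> Field p" for x y
    using iff[OF that] sub that unfolding inclusion_order_def relation_of_def by auto
  have "poset_isomorphic (Restr (inclusion_order F) ?G) p"
    unfolding poset_isomorphic_def Field_Restr_inclusion_order[OF sub]
  proof (intro exI[of _ "inv_into (Field p) f"] conjI ballI)
    show "bij_betw (inv_into (Field p) f) ?G (Field p)"
      using inj by (intro bij_betw_inv_into) (simp add: bij_betw_def)
  qed (use inj order in auto)
  moreover have "?G \<subseteq> Field (inclusion_order F)"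
    using sub by (simp add: Field_inclusion_order)
  moreover have "(f x, f y) \<in> inclusion_order F" if "(x, y) \<in> p" for x y
    using order that by (meson FieldI1 FieldI2)
  ultimately show "contains_induced_copy (inclusion_order F) p"
    unfolding contains_induced_copy_def using inj by (intro exI[of _ f]) auto
qed

lemma linear_sum_simps [simp]:
  "(Inl x, Inl y) \<in> linear_sum r s \<longleftrightarrow> (x, y) \<in> r"
  "(Inr u, Inr v) \<in> linear_sum r s \<longleftrightarrow> (u, v) \<in> s"
  "(Inr u, Inl x) \<in> linear_sum r s \<longleftrightarrow> x \<in> Field r \<and> u \<in> Field s"
  "(Inl x, Inr u) \<notin> linear_sum r s"
  unfolding linear_sum_def by auto

lemma Field_linear_sum: "Field (linear_sum r s) = Inl ` Field r \<union> Inr ` Field s"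
proof (intro equalityI subsetI)
  fix z
  assume "z \<in> Field (linear_sum r s)"
  then obtain z' where "(z, z') \<in> linear_sum r s \<or> (z', z) \<in> linear_sum r s"
    unfolding Field_def by auto
  then show "z \<in> Inl ` Field r \<union> Inr ` Field s"
    by (cases z; cases z') (auto intro: FieldI1 FieldI2)
next
  fix z
  assume "z \<in> Inl ` Field r \<union> Inr ` Field s"
  then consider x y where "z = Inl x" "(x, y) \<in> r \<or> (y, x) \<in> r"
    | u v where "z = Inr u" "(u, v) \<in> s \<or> (v, u) \<in> s"
    unfolding Field_def by auto
  then show "z \<in> Field (linear_sum r s)"
  proof cases
    case 1
    then have "(z, Inl y) \<in> linear_sum r s \<or> (Inl y, z) \<in> linear_sum r s"
      by simp
    then show ?thesis
      by (auto intro: FieldI1 FieldI2)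
  next
    case 2
    then have "(z, Inr v) \<in> linear_sum r s \<or> (Inr v, z) \<in> linear_sum r s"
      by simp
    then show ?thesis
      by (auto intro: FieldI1 FieldI2)
  qed
qed

lemma antisym_linear_sum:
  assumes "antisym r" "antisym s"
  shows "antisym (linear_sum r s)"
proof (rule antisymI)
  fix x y
  assume "(x, y) \<in> linear_sum r s" "(y, x) \<in> linear_sum r s"
  then show "x = y"
    using assms by (cases x; cases y) (auto dest: antisymD)
qed

lemma copy_linear_sum:
  "copy (linear_sum r s) \<G> \<longleftrightarrow>
     (\<exists>\<T> \<L>. \<G> = \<T> \<union> \<L> \<and> copy r \<T> \<and> copy s \<L> \<and> below \<L> \<T>)"
proof
  assume "copy (linear_sum r s) \<G>"
  then obtain f where G: "\<G> = f ` Field (linear_sum r s)"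
    and f: "\<And>x y. x \<in> Field (linear_sum r s) \<Longrightarrow> y \<in> Field (linear_sum r s) \<Longrightarrow>
      (x, y) \<in> linear_sum r s \<longleftrightarrow> f x \<subseteq> f y"
    by (rule copyE) blast
  let ?T = "(\<lambda>x. f (Inl x)) ` Field r" and ?L = "(\<lambda>x. f (Inr x)) ` Field s"
  have "copy r ?T"
    using f[of "Inl _" "Inl _"]
    by (intro copyI[of _ "\<lambda>x. f (Inl x)"]) (simp_all add: Field_linear_sum)
  moreover have "copy s ?L"
    using f[of "Inr _" "Inr _"]
    by (intro copyI[of _ "\<lambda>x. f (Inr x)"]) (simp_all add: Field_linear_sum)
  moreover have "below ?L ?T"
  proof -
    have "f (Inr u) \<subset> f (Inl x)" if "x \<in> Field r" "u \<in> Field s" for x u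
      using f[of "Inr u" "Inl x"] f[of "Inl x" "Inr u"] that
      by (simp add: Field_linear_sum less_le_not_le)
    then show ?thesis
      unfolding below_def by auto
  qed
  moreover have "\<G> = ?T \<union> ?L"
    unfolding G Field_linear_sum by (simp add: image_Un image_image)
  ultimately show "\<exists>\<T> \<L>. \<G> = \<T> \<union> \<L> \<and> copy r \<T> \<and> copy s \<L> \<and> below \<L> \<T>"
    by (intro exI conjI)
next
  assume "\<exists>\<T> \<L>. \<G> = \<T> \<union> \<L> \<and> copy r \<T> \<and> copy s \<L> \<and> below \<L> \<T>"
  then obtain \<T> \<L> where G: "\<G> = \<T> \<union> \<L>" "copy r \<T>" "copy s \<L>" "below \<L> \<T>"
    by auto
  from G(2) obtain g where T: "\<T> = g ` Field r"
    and g: "\<And>x y. x \<in> Field r \<Longrightarrow> y \<in> Field r \<Longrightarrow> (x, y) \<in> r \<longleftrightarrow> g x \<subseteq> g y"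
    by (rule copyE) blast
  from G(3) obtain h where L: "\<L> = h ` Field s"
    and h: "\<And>x y. x \<in> Field s \<Longrightarrow> y \<in> Field s \<Longrightarrow> (x, y) \<in> s \<longleftrightarrow> h x \<subseteq> h y"
    by (rule copyE) blast
  have hg: "h u \<subseteq> g x" "\<not> g x \<subseteq> h u" if "x \<in> Field r" "u \<in> Field s" for x u
    using G(4) that unfolding T L below_def by auto
  show "copy (linear_sum r s) \<G>"
  proof (rule copyI)
    show "\<G> = case_sum g h ` Field (linear_sum r s)"
      unfolding G(1) T L Field_linear_sum by (simp add: image_Un image_image)
  next
    fix x y
    assume "x \<in> Field (linear_sum r s)" "y \<in> Field (linear_sum r s)"
    then show "(x, y) \<in> linear_sum r s \<longleftrightarrow> case_sum g h x \<subseteq> case_sum g h y"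
      using g h hg unfolding Field_linear_sum by (elim UnE imageE) simp_all
  qed
qed

lemma Field_antichain_poset: "Field (antichain_poset k) = {1..k}"
  unfolding antichain_poset_def Field_def by auto

lemma copy_antichain_poset:
  assumes "k \<ge> 1"
  shows "copy (antichain_poset k) \<A> \<longleftrightarrow> antichain \<A> \<and> card \<A> = k"
proof
  assume "copy (antichain_poset k) \<A>"
  then obtain f where image: "\<A> = f ` Field (antichain_poset k)"
    and embed: "\<And>x y. x \<in> Field (antichain_poset k) \<Longrightarrow> y \<in> Field (antichain_poset k) \<Longrightarrow>
      (x, y) \<in> antichain_poset k \<longleftrightarrow> f x \<subseteq> f y"
    by (rule copyE) blast
  note A = image[unfolded Field_antichain_poset]
  note order = embed[unfolded Field_antichain_poset]
  have f: "f x \<subseteq> f y \<longleftrightarrow> x = y" if "x \<in> {1..k}" "y \<in> {1..k}" for x y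
    unfolding order[OF that, symmetric] using that by (auto simp: antichain_poset_def)
  have "inj_on f {1..k}"
    using f by (intro inj_onI) (metis order_refl)
  then have "card \<A> = k"
    unfolding A by (simp add: card_image)
  moreover have "antichain \<A>"
    unfolding antichain_def A by (auto simp: f)
  ultimately show "antichain \<A> \<and> card \<A> = k"
    by simp
next
  assume A: "antichain \<A> \<and> card \<A> = k"
  then have "finite \<A>"
    using assms by (intro card_ge_0_finite) simp
  then obtain f where f: "bij_betw f {1..k} \<A>"
    using A ex_bij_betw_nat_finite_1 by metis
  have "(x, y) \<in> antichain_poset k \<longleftrightarrow> f x \<subseteq> f y" if "x \<in> {1..k}" "y \<in> {1..k}" for x y
  proof -
    have "f x \<in> \<A>" "f y \<in> \<A>"
      using bij_betwE[OF f] that by auto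
    then have "f x \<subseteq> f y \<longleftrightarrow> f x = f y"
      using A unfolding antichain_def by blast
    also have "\<dots> \<longleftrightarrow> x = y"
      using f that by (auto simp: bij_betw_def dest: inj_onD)
    finally show ?thesis
      using that by (auto simp: antichain_poset_def)
  qed
  then show "copy (antichain_poset k) \<A>"
    using f by (intro copyI[of _ f]) (simp_all add: Field_antichain_poset bij_betw_def)
qed

lemma contains_sandwich_iff_layered:
  assumes "antisym P1" "antisym P2" "k \<ge> 2"
  shows "contains_induced_copy (inclusion_order F)
           (linear_sum (linear_sum P1 (antichain_poset k)) P2)
         \<longleftrightarrow> layered (copy P1) k (copy P2) F"
proof -
  have "antisym (antichain_poset k)"
    unfolding antichain_poset_def by (auto intro: antisymI)
  then have "antisym (linear_sum (linear_sum P1 (antichain_poset k)) P2)"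
    using assms by (intro antisym_linear_sum)
  note iff = contains_induced_copy_iff[OF this]
  have antichain_iff: "copy (antichain_poset k) \<A> \<longleftrightarrow> antichain \<A> \<and> card \<A> = k"
    for \<A> :: "'c set set"
    using assms(3) by (intro copy_antichain_poset) simp
  show ?thesis
    unfolding iff
  proof
    assume "\<exists>\<G>\<subseteq>F. copy (linear_sum (linear_sum P1 (antichain_poset k)) P2) \<G>"
    then obtain \<T> \<A> \<L> where "(\<T> \<union> \<A>) \<union> \<L> \<subseteq> F" "copy P1 \<T>"
      "antichain \<A>" "card \<A> = k" "below \<A> \<T>" "copy P2 \<L>" "below \<L> (\<T> \<union> \<A>)"
      unfolding copy_linear_sum antichain_iff by auto
    then show "layered (copy P1) k (copy P2) F"
      unfolding layered_def below_def
      by (intro exI[of _ \<T>] exI[of _ \<A>] exI[of _ \<L>]) simp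
  next
    assume "layered (copy P1) k (copy P2) F"
    then obtain \<T> \<A> \<L> where L: "\<T> \<subseteq> F" "\<A> \<subseteq> F" "\<L> \<subseteq> F" "copy P1 \<T>"
      "copy P2 \<L>" "antichain \<A>" "card \<A> = k" "below \<A> \<T>" "below \<L> \<A>"
      unfolding layered_def by auto
    then obtain A where A: "A \<in> \<A>"
      using assms(3) by fastforce
    have "L \<subset> T" if "L \<in> \<L>" "T \<in> \<T>" for L T
    proof -
      have "L \<subset> A" "A \<subset> T"
        using L(8,9) A that unfolding below_def by simp_all
      then show ?thesis
        by (rule psubset_trans)
    qed
    then have "below \<L> (\<T> \<union> \<A>)"
      using L(9) unfolding below_def by (simp add: ball_Un)
    then have "copy (linear_sum (linear_sum P1 (antichain_poset k)) P2) ((\<T> \<union> \<A>) \<union> \<L>)"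
      unfolding copy_linear_sum antichain_iff using L
      by (intro exI conjI) (assumption | rule refl)+
    then show "\<exists>\<G>\<subseteq>F. copy (linear_sum (linear_sum P1 (antichain_poset k)) P2) \<G>"
      using L(1-3) by (intro exI[of _ "(\<T> \<union> \<A>) \<union> \<L>"]) simp
  qed
qed

theorem theorem13:
  fixes P1 :: "'a rel" and P2 :: "'b rel" and k n :: nat and F :: "nat set set"
  assumes "Partial_order P1" and "finite (Field P1)"
    and "Partial_order P2" and "finite (Field P2)"
    and "k \<ge> 2" and "n \<ge> 1"
    and "saturated n (linear_sum (linear_sum P1 (antichain_poset k)) P2) F"
  shows "real (card F) \<ge> (real n + 1) / 9"
proof -
  have "antisym P1" "antisym P2"
    using assms(1,3) by (simp_all add: partial_order_on_def)
  note iff = contains_sandwich_iff_layered[OF this \<open>k \<ge> 2\<close>]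
  interpret layered_saturated "{1..n}" F "copy P1" "copy P2" k
    by unfold_locales (use assms(5,7) in \<open>auto simp: saturated_def iff\<close>)
  have "n \<le> card F + 1"
    using card_ground_le by simp
  moreover have "card F \<ge> 1"
    using finite_F F_nonempty by (simp add: Suc_le_eq card_gt_0_iff)
  ultimately show ?thesis
    by simp
qed

end
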